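(* Let $\mathcal{G}=(\Lambda,e)$ be a finite two-dimensional square lattice with nearest-neighbour edges, and let $\theta=\{w_{ij},a_i,b_i\}$ be a family of real coupling constants, with one constant $w_{ij}=w_{ji}$ for each edge $\{i,j\}\in e$ and constants $a_i,b_i$ for each $i\in\Lambda$. For $\phi=(\phi_i)_{i\in\Lambda}\in\mathbb{R}^{\Lambda}$ define the inhomogeneous $\phi^4$ lattice action $$S(\phi;\theta)=-\sum_{\langle ij\rangle} w_{ij}\,\phi_i\phi_j+\sum_{i\in\Lambda} a_i\phi_i^2+\sum_{i\in\Lambda} b_i\phi_i^4 ,$$ where $\langle ij\rangle$ indicates that the sum runs over the edges $\{i,j\}\in e$, each counted once. Assume that $Z=\int_{\mathbb{R}^\Lambda} \exp[-S(\bm{\phi};\theta)]\,d\bm{\phi}$ is finite, and let $p$ be the probability density (with respect to Lebesgue measure on $\mathbb{R}^\Lambda$) $$p(\phi;\theta)=\frac{\exp[-S(\phi;\theta)]}{\int_{\mathbb{R}^\Lambda}\exp[-S(\bm{\phi};\theta)]\,d\bm{\phi}} .$$ Then the random variables $(\phi_i)_{i\in\Lambda}$ with joint density $p(\cdot\,;\theta)$ form a Markov random field with respect to $\mathcal{G}$; that is, $p$ satisfies the local Markov property: for every $i\in\Lambda$ and Lebesgue-almost every $\phi\in\mathbb{R}^\Lambda$, $$p\big(\phi_i \,\big|\, (\phi_j)_{j\in\Lambda\setminus\{i\}}\big)=p\big(\phi_i \,\big|\, (\phi_j)_{j\in\mathcal{N}_i}\big),$$ where $\mathcal{N}_i=\{j\in\Lambda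 : \{i,j\}\in e\}$ is the set of neighbours of $i$.
   Context: The finite two-dimensional square lattice is the finite simple graph $\mathcal{G}=(\Lambda,e)$ whose vertex set consists of $L\times L$ lattice points, $L\ge 1$, two distinct points being joined by an edge exactly when they are nearest neighbours (differ by one unit in exactly one coordinate direction), with either free or periodic boundary conditions. Two points $i,j\in\Lambda$ are neighbours if there is an edge between them. To each $i\in\Lambda$ is associated a real-valued random variable $\phi_i$. For $A\subseteq\Lambda\setminus\{i\}$, $p(\phi_i\mid(\phi_j)_{j\in A})$ denotes the conditional density of $\phi_i$ given $(\phi_j)_{j\in A}$, i.e. the ratio of the marginal density of $(\phi_j)_{j\in A\cup\{i\}}$ to the marginal density of $(\phi_j)_{j\in A}$ (for $A=\emptyset$, simply the marginal density of $\phi_i$). A family of random variables indexed by the vertices of a graph is a Markov random field if its joint distribution satisfies the local Markov property with respect to that graph, as stated in the claim. *)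

theory Defs
  imports "HOL-Probability.Probability"
begin

datatype boundary = Free | Periodic

definition lattice_vertices :: "nat \<Rightarrow> (nat \<times> nat) set" where
  "lattice_vertices L = {..<L} \<times> {..<L}"

fun unit_step :: "boundary \<Rightarrow> nat \<Rightarrow> nat \<Rightarrow> nat \<Rightarrow> bool" where
  "unit_step Free L x y \<longleftrightarrow> x + 1 = y \<or> y + 1 = x"
| "unit_step Periodic L x y \<longleftrightarrow> (x + 1) mod L = y \<or> (y + 1) mod L = x"

text \<open>The lattice is a simple graph: edges are unordered pairs of distinct points. The condition
  \<open>i \<noteq> j\<close> only matters for \<open>L = 1\<close> with periodic boundary, where it excludes the loop; for
  \<open>L = 2\<close> with periodic boundary the two wrap-around steps give the same single edge.\<close>

definition lattice_edges :: "boundary \<Rightarrow> nat \<Rightarrow> (nat \<times> nat) set set" where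
  "lattice_edges bc L =
     {{i, j} | i j. i \<in> lattice_vertices L \<and> j \<in> lattice_vertices L \<and> i \<noteq> j \<and>
        (unit_step bc L (fst i) (fst j) \<and> snd i = snd j \<or>
         fst i = fst j \<and> unit_step bc L (snd i) (snd j))}"

definition neighbours :: "'v set \<Rightarrow> 'v set set \<Rightarrow> 'v \<Rightarrow> 'v set" where
  "neighbours V E i = {j \<in> V. {i, j} \<in> E}"

text \<open>Lebesgue measure on \<open>\<real>\<^sup>V\<close>, a configuration being a function that is \<open>undefined\<close> outside \<open>V\<close>.\<close>

abbreviation lebesgue_PiM :: "'v set \<Rightarrow> ('v \<Rightarrow> real) measure" where
  "lebesgue_PiM V \<equiv> Pi\<^sub>M V (\<lambda>_. lborel)"

text \<open>Given a joint density \<open>f\<close> on \<open>\<real>\<^sup>V\<close>, the marginal density of the coordinates in \<open>A \<subseteq> V\<close>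
  is obtained by integrating out the coordinates in \<open>V - A\<close>. It depends on \<open>\<phi>\<close> only through
  \<open>\<phi>\<close> restricted to \<open>A\<close>.\<close>

definition marginal_density ::
    "'v set \<Rightarrow> (('v \<Rightarrow> real) \<Rightarrow> ennreal) \<Rightarrow> 'v set \<Rightarrow> ('v \<Rightarrow> real) \<Rightarrow> ennreal" where
  "marginal_density V f A \<phi> = (\<integral>\<^sup>+ \<psi>. f (merge A (V - A) (\<phi>, \<psi>)) \<partial>lebesgue_PiM (V - A))"

definition conditional_density ::
    "'v set \<Rightarrow> (('v \<Rightarrow> real) \<Rightarrow> ennreal) \<Rightarrow> 'v \<Rightarrow> 'v set \<Rightarrow> ('v \<Rightarrow> real) \<Rightarrow> ennreal" where
  "conditional_density V f i A \<phi> = marginal_density V f (insert i A) \<phi> / marginal_density V f A \<phi>"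

definition local_markov_property ::
    "'v set \<Rightarrow> 'v set set \<Rightarrow> (('v \<Rightarrow> real) \<Rightarrow> ennreal) \<Rightarrow> bool" where
  "local_markov_property V E f \<longleftrightarrow>
     (\<forall>i\<in>V. AE \<phi> in lebesgue_PiM V.
        conditional_density V f i (V - {i}) \<phi> = conditional_density V f i (neighbours V E i) \<phi>)"

definition has_joint_density ::
    "'w measure \<Rightarrow> 'v set \<Rightarrow> ('v \<Rightarrow> 'w \<Rightarrow> real) \<Rightarrow> (('v \<Rightarrow> real) \<Rightarrow> ennreal) \<Rightarrow> bool" where
  "has_joint_density M V X f \<longleftrightarrow> distributed M (lebesgue_PiM V) (\<lambda>\<omega>. \<lambda>i\<in>V. X i \<omega>) f"

text \<open>A joint density is only determined up to null sets; the local Markov property is required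
  of every version.\<close>

definition markov_random_field ::
    "'w measure \<Rightarrow> 'v set \<Rightarrow> 'v set set \<Rightarrow> ('v \<Rightarrow> 'w \<Rightarrow> real) \<Rightarrow> bool" where
  "markov_random_field M V E X \<longleftrightarrow>
     prob_space M \<and> (\<exists>f. has_joint_density M V X f) \<and>
     (\<forall>f. has_joint_density M V X f \<longrightarrow> local_markov_property V E f)"

text \<open>The coupling \<open>w\<close> is indexed by edges \<open>{i, j}\<close>, so that \<open>w\<^sub>i\<^sub>j = w\<^sub>j\<^sub>i\<close>; for such an edge \<open>e\<close> the
  product over \<open>e\<close> is \<open>\<phi> i * \<phi> j\<close>.\<close>

definition phi4_action ::
    "'v set \<Rightarrow> 'v set set \<Rightarrow> ('v set \<Rightarrow> real) \<Rightarrow> ('v \<Rightarrow> real) \<Rightarrow> ('v \<Rightarrow> real) \<Rightarrow> ('v \<Rightarrow> real) \<Rightarrow> real" where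
  "phi4_action V E w a b \<phi> =
     - (\<Sum>e\<in>E. w e * (\<Prod>i\<in>e. \<phi> i)) + (\<Sum>i\<in>V. a i * \<phi> i ^ 2) + (\<Sum>i\<in>V. b i * \<phi> i ^ 4)"

definition partition_function ::
    "'v set \<Rightarrow> 'v set set \<Rightarrow> ('v set \<Rightarrow> real) \<Rightarrow> ('v \<Rightarrow> real) \<Rightarrow> ('v \<Rightarrow> real) \<Rightarrow> ennreal" where
  "partition_function V E w a b =
     (\<integral>\<^sup>+ \<phi>. ennreal (exp (- phi4_action V E w a b \<phi>)) \<partial>lebesgue_PiM V)"

definition phi4_density ::
    "'v set \<Rightarrow> 'v set set \<Rightarrow> ('v set \<Rightarrow> real) \<Rightarrow> ('v \<Rightarrow> real) \<Rightarrow> ('v \<Rightarrow> real) \<Rightarrow> ('v \<Rightarrow> real) \<Rightarrow> real" where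
  "phi4_density V E w a b \<phi> =
     exp (- phi4_action V E w a b \<phi>) / enn2real (partition_function V E w a b)"

end

(*
  Collecting the terms of the action that contain phi_i gives p = g * h, where g depends only on
  phi_i and its neighbours and h does not depend on phi_i. For any set A of coordinates with
  N_i <= A <= V - {i}, integrating out the coordinates outside A and {i} only affects h, and turns
  it into some H; integrating out phi_i as well only affects g. So the conditional density of
  phi_i given A is g H / (H * integral of g over phi_i). Here H is positive, and it is finite
  almost everywhere because Z is finite, so H cancels and the result is the same for A = V - {i}
  and A = N_i.
*)
theory Submission
  imports Defs
begin

interpretation lborel_product: product_sigma_finite "\<lambda>_ :: 'v. lborel :: real measure"
  by standard

section \<open>Marginal densities\<close>

lemma merge_restrict_left: "merge A B (restrict \<phi> A, \<psi>) = merge A B (\<phi>, \<psi>)"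
  by (auto simp: merge_def fun_eq_iff)

lemma marginal_density_restrict:
  "marginal_density V f A (restrict \<phi> A) = marginal_density V f A \<phi>"
  by (simp add: marginal_density_def merge_restrict_left)

lemma measurable_merge_section:
  assumes "A \<subseteq> V" "f \<in> borel_measurable (lebesgue_PiM V)"
  shows "(\<lambda>\<psi>. f (merge A (V - A) (\<phi>, \<psi>))) \<in> borel_measurable (lebesgue_PiM (V - A))"
proof -
  have V: "A \<union> V = V" using assms(1) by auto
  \<comment> \<open>An arbitrary \<open>\<phi>\<close> need not be \<open>undefined\<close> outside
    \<open>A\<close>. Its restriction is a genuine point of the product space, and
    \<open>merge\<close> does not see the difference.\<close>
  have "(\<lambda>\<psi>. (restrict \<phi> A, \<psi>))
      \<in> lebesgue_PiM (V - A) \<rightarrow>\<^sub>M lebesgue_PiM A \<Otimes>\<^sub>M lebesgue_PiM (V - A)"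
    by (intro measurable_Pair1') (simp add: space_PiM)
  from measurable_compose[OF this measurable_merge]
  have "(\<lambda>\<psi>. merge A (V - A) (restrict \<phi> A, \<psi>)) \<in> lebesgue_PiM (V - A) \<rightarrow>\<^sub>M lebesgue_PiM V"
    by (simp add: V)
  from measurable_compose[OF this assms(2)] show ?thesis
    by (simp add: merge_restrict_left)
qed

lemma measurable_marginal_density:
  assumes "finite V" "A \<subseteq> V" "f \<in> borel_measurable (lebesgue_PiM V)"
  shows "marginal_density V f A \<in> borel_measurable (lebesgue_PiM A)"
proof -
  interpret C: sigma_finite_measure "lebesgue_PiM (V - A)"
    using assms(1) by (intro lborel_product.sigma_finite) auto
  have V: "A \<union> V = V" using assms(2) by auto
  have "merge A (V - A) \<in> lebesgue_PiM A \<Otimes>\<^sub>M lebesgue_PiM (V - A) \<rightarrow>\<^sub>M lebesgue_PiM V"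
    using measurable_merge[of A "V - A" "\<lambda>_. lborel"] by (simp add: V)
  from measurable_compose[OF this assms(3)] show ?thesis
    unfolding marginal_density_def by measurable
qed

text \<open>Tonelli for the splitting of the coordinates into \<open>A\<close> and
  \<open>V - A\<close>.\<close>

lemma nn_integral_marginal_density:
  assumes "finite V" "A \<subseteq> V" "f \<in> borel_measurable (lebesgue_PiM V)"
  shows "(\<integral>\<^sup>+ \<phi>. marginal_density V f A \<phi> \<partial>lebesgue_PiM A) = (\<integral>\<^sup>+ \<phi>. f \<phi> \<partial>lebesgue_PiM V)"
proof -
  have V: "A \<union> V = V" using assms(2) by auto
  show ?thesis
    using lborel_product.product_nn_integral_fold[of A "V - A" f] assms finite_subset[OF assms(2,1)]
    unfolding marginal_density_def by (simp add: V)
qed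

text \<open>Tonelli again, for the single coordinate \<open>i\<close> and pointwise in
  \<open>\<phi>\<close>: integrating out \<open>V - A\<close> means integrating out
  \<open>V - insert i A\<close> first and \<open>i\<close> afterwards.\<close>

lemma marginal_density_remove:
  assumes "finite V" "insert i A \<subseteq> V" "i \<notin> A" "f \<in> borel_measurable (lebesgue_PiM V)"
  shows "marginal_density V f A \<phi> = (\<integral>\<^sup>+ y. marginal_density V f (insert i A) (\<phi>(i := y)) \<partial>lborel)"
proof -
  define C where "C = V - insert i A"
  have C: "V - A = insert i C" "finite C" "i \<notin> C" using assms by (auto simp: C_def)
  have eq: "merge A (insert i C) (\<phi>, \<psi>(i := y)) = merge (insert i A) C (\<phi>(i := y), \<psi>)" for \<psi> y
    using assms(3) by (auto simp: merge_def fun_eq_iff)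
  have "(\<lambda>\<psi>. f (merge A (insert i C) (\<phi>, \<psi>))) \<in> borel_measurable (lebesgue_PiM (insert i C))"
    using measurable_merge_section[of A V f \<phi>] assms by (simp add: C)
  from lborel_product.product_nn_integral_insert_rev[OF C(2,3) this] show ?thesis
    unfolding marginal_density_def C(1) C_def[symmetric] by (simp add: eq)
qed

section \<open>Null sets under slicing and restriction of coordinates\<close>

lemma AE_lebesgue_PiM_merge:
  assumes "finite V" "A \<subseteq> V" "AE \<phi> in lebesgue_PiM V. P \<phi>"
  shows "AE \<phi> in lebesgue_PiM A. AE \<psi> in lebesgue_PiM (V - A). P (merge A (V - A) (\<phi>, \<psi>))"
proof -
  interpret A: sigma_finite_measure "lebesgue_PiM A"
    using assms finite_subset by (intro lborel_product.sigma_finite) auto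
  interpret C: sigma_finite_measure "lebesgue_PiM (V - A)"
    using assms(1) by (intro lborel_product.sigma_finite) auto
  interpret pair_sigma_finite "lebesgue_PiM A" "lebesgue_PiM (V - A)" ..
  have V: "A \<union> V = V" using assms(2) by auto
  have m: "merge A (V - A) \<in> lebesgue_PiM A \<Otimes>\<^sub>M lebesgue_PiM (V - A) \<rightarrow>\<^sub>M lebesgue_PiM V"
    using measurable_merge[of A "V - A" "\<lambda>_. lborel"] by (simp add: V)
  \<comment> \<open>Lebesgue measure on the full space is the image of the product measure under
    \<open>merge\<close>, so Fubini applies: almost every slice of a null set is null.\<close>
  have d: "distr (lebesgue_PiM A \<Otimes>\<^sub>M lebesgue_PiM (V - A)) (lebesgue_PiM V) (merge A (V - A))
      = lebesgue_PiM V"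
    using lborel_product.distr_merge[of A "V - A"] assms(1) finite_subset[OF assms(2,1)]
    by (simp add: V)
  have "AE \<phi> in distr (lebesgue_PiM A \<Otimes>\<^sub>M lebesgue_PiM (V - A))
      (lebesgue_PiM V) (merge A (V - A)). P \<phi>"
    unfolding d by (rule assms(3))
  from AE_pair[OF AE_distrD[OF m this]] show ?thesis .
qed

lemma AE_lebesgue_PiM_restrict:
  assumes "finite V" "A \<subseteq> V" "AE \<phi> in lebesgue_PiM A. P \<phi>"
  shows "AE \<phi> in lebesgue_PiM V. P (restrict \<phi> A)"
proof -
  obtain N where N: "{\<phi> \<in> space (lebesgue_PiM A). \<not> P \<phi>} \<subseteq> N"
      "emeasure (lebesgue_PiM A) N = 0" "N \<in> sets (lebesgue_PiM A)"
    using assms(3) by (rule AE_E)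
  \<comment> \<open>This is the indicator of the cylinder over \<open>N\<close>. For proper subsets
    \<open>A\<close> of \<open>V\<close>, restriction does not preserve Lebesgue measure, so the
    cylinder is shown to be null by integrating \<open>g\<close> with Tonelli.\<close>
  define g :: "_ \<Rightarrow> ennreal" where "g \<phi> = indicator N (restrict \<phi> A)" for \<phi>
  have r: "(\<lambda>\<phi>. restrict \<phi> A) \<in> lebesgue_PiM V \<rightarrow>\<^sub>M lebesgue_PiM A"
    by (rule measurable_restrict_subset[OF assms(2)])
  have g[measurable]: "g \<in> borel_measurable (lebesgue_PiM V)"
    unfolding g_def using measurable_compose[OF r borel_measurable_indicator[OF N(3)]] .
  have g_merge: "g (merge A (V - A) (\<phi>, \<psi>)) = indicator N \<phi>"
    if "\<phi> \<in> space (lebesgue_PiM A)" for \<phi> \<psi>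
    using that by (simp add: g_def restrict_merge space_PiM PiE_restrict)
  have N_AE: "AE \<phi> in lebesgue_PiM A. \<phi> \<notin> N"
    using N(2,3) by (intro AE_not_in) (auto simp: null_sets_def)
  have "(\<integral>\<^sup>+ \<phi>. g \<phi> \<partial>lebesgue_PiM V) = (\<integral>\<^sup>+ \<phi>. marginal_density V g A \<phi> \<partial>lebesgue_PiM A)"
    by (rule nn_integral_marginal_density[symmetric, OF assms(1,2) g])
  \<comment> \<open>Over points of \<open>N\<close> the marginal of \<open>g\<close> may be
    infinite, but \<open>N\<close> is null; elsewhere it is \<open>0\<close>.\<close>
  also have "\<dots> = (\<integral>\<^sup>+ \<phi>. 0 \<partial>lebesgue_PiM A)"
    using N_AE AE_space by (intro nn_integral_cong_AE) (auto simp: marginal_density_def g_merge)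
  finally have "AE \<phi> in lebesgue_PiM V. g \<phi> = 0"
    by (simp add: nn_integral_0_iff_AE)
  then show ?thesis
    using AE_space
  proof eventually_elim
    case (elim \<phi>)
    then have "restrict \<phi> A \<notin> N" "restrict \<phi> A \<in> space (lebesgue_PiM A)"
      using measurable_space[OF r elim(2)] by (auto simp: g_def indicator_def split: if_splits)
    with N(1) show ?case by auto
  qed
qed

text \<open>Almost every slice of the exceptional null set is null, so the integrals over
  \<open>V - A\<close> agree almost everywhere on the \<open>A\<close>-coordinates; marginals see
  only these coordinates, which lifts the statement to \<open>V\<close>.\<close>

lemma AE_marginal_density_cong:
  assumes "finite V" "A \<subseteq> V" "AE \<phi> in lebesgue_PiM V. f \<phi> = f' \<phi>"
  shows "AE \<phi> in lebesgue_PiM V. marginal_density V f A \<phi> = marginal_density V f' A \<phi>"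
proof -
  have "AE \<phi> in lebesgue_PiM A. marginal_density V f A \<phi> = marginal_density V f' A \<phi>"
    using AE_lebesgue_PiM_merge[OF assms]
    by eventually_elim (auto simp: marginal_density_def intro: nn_integral_cong_AE)
  from AE_lebesgue_PiM_restrict[OF assms(1,2) this] show ?thesis
    by (simp add: marginal_density_restrict)
qed

lemma marginal_density_nonzero:
  assumes "finite V" "A \<subseteq> V" "h \<in> borel_measurable (lebesgue_PiM V)" "\<And>\<phi>. h \<phi> \<noteq> 0"
  shows "marginal_density V h A \<phi> \<noteq> 0"
proof
  have fin: "finite (V - A)" using assms(1) by simp
  assume "marginal_density V h A \<phi> = 0"
  then have "AE \<psi> in lebesgue_PiM (V - A). False"
    using assms(4)
    by (simp add: marginal_density_def nn_integral_0_iff_AE measurable_merge_section assms)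
  then have "emeasure (lebesgue_PiM (V - A)) (space (lebesgue_PiM (V - A))) = 0"
    by (simp add: AE_iff_measurable[OF sets.top])
  then show False
    \<comment> \<open>The total mass is a product of infinite one-dimensional masses, or the empty
      product \<open>1\<close> when \<open>A = V\<close>; it is never \<open>0\<close>.\<close>
    using lborel_product.emeasure_PiM[OF fin, of "\<lambda>_. UNIV"] fin
    by (simp add: space_PiM emeasure_lborel_UNIV)
qed

section \<open>Factorising densities\<close>

text \<open>The quotient on the right does not mention \<open>A\<close>, which is what makes
  different conditioning sets comparable. It arises by cancelling the marginal \<open>H\<close> of
  \<open>h\<close>, possible wherever \<open>H\<close> is neither \<open>0\<close> nor
  infinite.\<close>

lemma AE_conditional_density_factorized:
  fixes g h :: "('v \<Rightarrow> real) \<Rightarrow> ennreal"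
  assumes V: "finite V" "insert i A \<subseteq> V" "i \<notin> A"
    and g: "g \<in> borel_measurable (lebesgue_PiM V)"
      "\<And>\<phi> \<psi>. \<forall>j\<in>insert i A. \<phi> j = \<psi> j \<Longrightarrow> g \<phi> = g \<psi>" "\<And>\<phi>. g \<phi> \<noteq> 0"
    and h: "h \<in> borel_measurable (lebesgue_PiM V)" "\<And>\<phi> y. h (\<phi>(i := y)) = h \<phi>" "\<And>\<phi>. h \<phi> \<noteq> 0"
    and fin: "(\<integral>\<^sup>+ \<phi>. g \<phi> * h \<phi> \<partial>lebesgue_PiM V) < \<infinity>"
  shows "AE \<phi> in lebesgue_PiM V.
    conditional_density V (\<lambda>\<phi>. g \<phi> * h \<phi>) i A \<phi> = g \<phi> / (\<integral>\<^sup>+ y. g (\<phi>(i := y)) \<partial>lborel)"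
proof -
  let ?f = "\<lambda>\<phi>. g \<phi> * h \<phi>" and ?B = "insert i A"
  define H where "H = marginal_density V h ?B"
  have f: "?f \<in> borel_measurable (lebesgue_PiM V)" using g(1) h(1) by measurable
  have g_merge: "g (merge ?B C (\<phi>, \<psi>)) = g \<phi>" for C \<phi> \<psi>
    by (rule g(2)) (auto simp: merge_def)
  have B: "marginal_density V ?f ?B \<phi> = g \<phi> * H \<phi>" for \<phi>
    unfolding marginal_density_def H_def g_merge
    by (intro nn_integral_cmult measurable_merge_section V h)
  have H_upd: "H (\<phi>(i := y)) = H \<phi>" for \<phi> y
  proof -
    have "merge ?B (V - ?B) (\<phi>(i := y), \<psi>) = (merge ?B (V - ?B) (\<phi>, \<psi>))(i := y)" for \<psi>
      by (auto simp: merge_def fun_eq_iff)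
    then show ?thesis by (simp add: H_def marginal_density_def h(2))
  qed
  have g_upd: "(\<lambda>y. g (\<phi>(i := y))) \<in> borel_measurable borel" for \<phi>
  proof -
    \<comment> \<open>Restricting first gives points of the product space for arbitrary
      \<open>\<phi>\<close>; \<open>g\<close> is unaffected, as it reads only coordinates in
      \<open>insert i A\<close>.\<close>
    have "(\<lambda>y. (restrict \<phi> (V - {i}))(i := y)) \<in> lborel \<rightarrow>\<^sub>M lebesgue_PiM V"
      using V(2) by (intro measurable_fun_upd[where J="V - {i}"] measurable_const) (auto simp: space_PiM)
    from measurable_compose[OF this g(1)]
    have "(\<lambda>y. g ((restrict \<phi> (V - {i}))(i := y))) \<in> borel_measurable borel" by simp
    also have "(\<lambda>y. g ((restrict \<phi> (V - {i}))(i := y))) = (\<lambda>y. g (\<phi>(i := y)))"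
      using V(2) by (intro ext g(2)) auto
    finally show ?thesis .
  qed
  \<comment> \<open>As a function of \<open>y\<close>, \<open>H\<close> is constant by
    \<open>H_upd\<close> and leaves the integral.\<close>
  have A: "marginal_density V ?f A \<phi> = (\<integral>\<^sup>+ y. g (\<phi>(i := y)) \<partial>lborel) * H \<phi>" for \<phi>
    unfolding marginal_density_remove[OF V f] B H_upd
    by (intro nn_integral_multc) (simp add: g_upd)
  \<comment> \<open>The marginal \<open>g * H\<close> has the finite integral of the joint function,
    hence is finite almost everywhere; since \<open>g\<close> is nonzero, \<open>H\<close> is finite
    there too.\<close>
  have "AE \<phi> in lebesgue_PiM ?B. marginal_density V ?f ?B \<phi> \<noteq> \<infinity>"
    using fin nn_integral_marginal_density[OF V(1,2) f]
    by (intro nn_integral_PInf_AE measurable_marginal_density[OF V(1,2) f]) auto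
  from AE_lebesgue_PiM_restrict[OF V(1,2) this]
  show ?thesis
  proof eventually_elim
    case (elim \<phi>)
    then have "H \<phi> \<noteq> \<infinity>"
      using g(3)[of \<phi>] by (auto simp: marginal_density_restrict B ennreal_mult_eq_top_iff)
    moreover have "H \<phi> \<noteq> 0"
      unfolding H_def by (rule marginal_density_nonzero[OF V(1,2) h(1,3)])
    ultimately show ?case
      by (simp add: conditional_density_def A B divide_mult_eq)
  qed
qed

text \<open>Both conditioning sets yield the same quotient. The larger one is admissible because a
  function of the coordinates in \<open>insert i N\<close> is also one of the coordinates in
  \<open>V\<close>.\<close>

corollary AE_conditional_density_factorized_eq:
  fixes g h :: "('v \<Rightarrow> real) \<Rightarrow> ennreal"
  assumes V: "finite V" "insert i N \<subseteq> V" "i \<notin> N"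
    and g: "g \<in> borel_measurable (lebesgue_PiM V)"
      "\<And>\<phi> \<psi>. \<forall>j\<in>insert i N. \<phi> j = \<psi> j \<Longrightarrow> g \<phi> = g \<psi>" "\<And>\<phi>. g \<phi> \<noteq> 0"
    and h: "h \<in> borel_measurable (lebesgue_PiM V)" "\<And>\<phi> y. h (\<phi>(i := y)) = h \<phi>" "\<And>\<phi>. h \<phi> \<noteq> 0"
    and fin: "(\<integral>\<^sup>+ \<phi>. g \<phi> * h \<phi> \<partial>lebesgue_PiM V) < \<infinity>"
  shows "AE \<phi> in lebesgue_PiM V. conditional_density V (\<lambda>\<phi>. g \<phi> * h \<phi>) i (V - {i}) \<phi> =
    conditional_density V (\<lambda>\<phi>. g \<phi> * h \<phi>) i N \<phi>"
proof -
  have "insert i (V - {i}) \<subseteq> V" "i \<notin> V - {i}" using V by auto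
  moreover have "g \<phi> = g \<psi>" if "\<forall>j\<in>insert i (V - {i}). \<phi> j = \<psi> j" for \<phi> \<psi>
    using that V(2) by (intro g(2)) auto
  ultimately have "AE \<phi> in lebesgue_PiM V. conditional_density V (\<lambda>\<phi>. g \<phi> * h \<phi>) i (V - {i}) \<phi> =
      g \<phi> / (\<integral>\<^sup>+ y. g (\<phi>(i := y)) \<partial>lborel)"
    by (rule AE_conditional_density_factorized[OF V(1) _ _ g(1) _ g(3) h fin])
  moreover have "AE \<phi> in lebesgue_PiM V. conditional_density V (\<lambda>\<phi>. g \<phi> * h \<phi>) i N \<phi> =
      g \<phi> / (\<integral>\<^sup>+ y. g (\<phi>(i := y)) \<partial>lborel)"
    by (rule AE_conditional_density_factorized[OF V g h fin])
  ultimately show ?thesis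
    by eventually_elim simp
qed

section \<open>Independence of the chosen version of the density\<close>

lemma local_markov_property_cong_AE:
  assumes "finite V" "AE \<phi> in lebesgue_PiM V. f \<phi> = f' \<phi>"
    and "local_markov_property V E f'"
  shows "local_markov_property V E f"
  unfolding local_markov_property_def
proof
  fix i assume i: "i \<in> V"
  have c: "AE \<phi> in lebesgue_PiM V. conditional_density V f i A \<phi> = conditional_density V f' i A \<phi>"
    if "A \<subseteq> V" for A
  proof -
    have "insert i A \<subseteq> V" using that i by simp
    from AE_marginal_density_cong[OF assms(1) this assms(2)]
      AE_marginal_density_cong[OF assms(1) that assms(2)]
    show ?thesis by eventually_elim (simp add: conditional_density_def)
  qed
  have f': "AE \<phi> in lebesgue_PiM V.
      conditional_density V f' i (V - {i}) \<phi> = conditional_density V f' i (neighbours V E i) \<phi>"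
    using assms(3) i by (simp add: local_markov_property_def)
  have "V - {i} \<subseteq> V" "neighbours V E i \<subseteq> V" by (auto simp: neighbours_def)
  from c[OF this(1)] c[OF this(2)] f' show "AE \<phi> in lebesgue_PiM V.
      conditional_density V f i (V - {i}) \<phi> = conditional_density V f i (neighbours V E i) \<phi>"
    by eventually_elim simp
qed

lemma has_joint_density_AE_unique:
  assumes "finite V" "has_joint_density M V X f" "has_joint_density M V X f'"
  shows "AE \<phi> in lebesgue_PiM V. f \<phi> = f' \<phi>"
proof -
  interpret sigma_finite_measure "lebesgue_PiM V"
    by (rule lborel_product.sigma_finite[OF assms(1)])
  show ?thesis
    using assms(2,3) unfolding has_joint_density_def distributed_def
    by (intro density_unique) auto
qed

section \<open>The lattice action\<close>

lemma finite_lattice_edges: "finite (lattice_edges bc L)"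
proof (rule finite_subset)
  show "lattice_edges bc L \<subseteq> Pow (lattice_vertices L)" by (auto simp: lattice_edges_def)
qed (simp add: lattice_vertices_def)

lemma measurable_prod_component:
  fixes e :: "'v set"
  assumes "e \<subseteq> V"
  shows "(\<lambda>\<phi>. \<Prod>i\<in>e. \<phi> i :: real) \<in> borel_measurable (lebesgue_PiM V)"
  using assms measurable_component_singleton[of _ V "\<lambda>_. lborel :: real measure"]
  by (intro borel_measurable_prod) (auto simp: measurable_lborel1)

text \<open>Both pieces are again instances of \<open>phi4_action\<close>, since that formula allows
  edges that leave the vertex set, as those at \<open>i\<close> leave \<open>{i}\<close>.\<close>

lemma phi4_action_remove:
  assumes "finite V" "finite E" "i \<in> V"
  shows "phi4_action V E w a b \<phi> =
    phi4_action {i} {e \<in> E. i \<in> e} w a b \<phi> + phi4_action (V - {i}) {e \<in> E. i \<notin> e} w a b \<phi>"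
proof -
  have E: "E = {e \<in> E. i \<in> e} \<union> {e \<in> E. i \<notin> e}" by auto
  have "(\<Sum>e\<in>E. w e * (\<Prod>i\<in>e. \<phi> i)) = (\<Sum>e\<in>{e \<in> E. i \<in> e}. w e * (\<Prod>i\<in>e. \<phi> i))
      + (\<Sum>e\<in>{e \<in> E. i \<notin> e}. w e * (\<Prod>i\<in>e. \<phi> i))"
    by (subst E, rule sum.union_disjoint) (use assms in auto)
  then show ?thesis
    using assms by (simp add: phi4_action_def sum.remove)
qed

lemma phi4_action_cong:
  assumes "\<And>j. j \<in> V \<union> \<Union>E \<Longrightarrow> \<phi> j = \<psi> j"
  shows "phi4_action V E w a b \<phi> = phi4_action V E w a b \<psi>"
proof -
  have "(\<Prod>i\<in>e. \<phi> i) = (\<Prod>i\<in>e. \<psi> i)" if "e \<in> E" for e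
    using that assms by (intro prod.cong) auto
  then show ?thesis using assms by (simp add: phi4_action_def)
qed

lemma measurable_phi4_action:
  assumes "W \<subseteq> V" "\<And>e. e \<in> E \<Longrightarrow> e \<subseteq> V"
  shows "phi4_action W E w a b \<in> borel_measurable (lebesgue_PiM V)"
proof -
  have [measurable]: "(\<lambda>\<phi>. \<phi> i) \<in> borel_measurable (lebesgue_PiM V)" if "i \<in> W" for i
    using measurable_component_singleton[of i V "\<lambda>_. lborel :: real measure"] that assms(1)
    by (auto simp: measurable_lborel1)
  show ?thesis
    unfolding phi4_action_def[abs_def] using assms(2)
    by (intro borel_measurable_add borel_measurable_uminus borel_measurable_sum
        borel_measurable_times borel_measurable_power measurable_prod_component) auto
qed

text \<open>The argument works on any finite simple graph: the terms of the action containing the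
  field at \<open>i\<close> involve only \<open>i\<close> and its neighbours, so the density
  factorises as required.\<close>

lemma phi4_local_markov_property:
  fixes V :: "'v set"
  assumes "finite V" "finite E"
    and edge: "\<And>e. e \<in> E \<Longrightarrow> \<exists>i j. e = {i, j} \<and> i \<in> V \<and> j \<in> V \<and> i \<noteq> j"
    and fin: "partition_function V E w a b < \<infinity>"
  shows "local_markov_property V E (\<lambda>\<phi>. ennreal (phi4_density V E w a b \<phi>))"
proof -
  let ?S = "phi4_action V E w a b"
  define Z where "Z = enn2real (partition_function V E w a b)"
  have sub: "e \<subseteq> V" if "e \<in> E" for e using edge[OF that] by auto
  have S: "?S \<in> borel_measurable (lebesgue_PiM V)"
    by (rule measurable_phi4_action) (use sub in auto)
  then have S': "(\<lambda>\<phi>. ennreal (exp (- ?S \<phi>))) \<in> borel_measurable (lebesgue_PiM V)"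
    by measurable
  \<comment> \<open>The partition function is the marginal over the empty set of coordinates, so
    positivity of marginals gives \<open>Z > 0\<close>.\<close>
  have "merge {} V (undefined, \<psi>) = \<psi>" if "\<psi> \<in> space (lebesgue_PiM V)" for \<psi>
    using that by (auto simp: merge_def space_PiM PiE_def extensional_def fun_eq_iff)
  then have "partition_function V E w a b =
      marginal_density V (\<lambda>\<phi>. ennreal (exp (- ?S \<phi>))) {} undefined"
    unfolding partition_function_def marginal_density_def by (auto intro!: nn_integral_cong)
  also have "\<dots> \<noteq> 0"
    by (rule marginal_density_nonzero) (use assms S' in auto)
  finally have Z: "Z > 0" using fin by (simp add: Z_def enn2real_positive_iff zero_less_iff_neq_zero)
  have "(\<lambda>\<phi>. ennreal (phi4_density V E w a b \<phi>)) = (\<lambda>\<phi>. ennreal (exp (- ?S \<phi>)) * ennreal (1 / Z))"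
    using Z by (simp add: phi4_density_def Z_def flip: ennreal_mult)
  then have "(\<integral>\<^sup>+ \<phi>. ennreal (phi4_density V E w a b \<phi>) \<partial>lebesgue_PiM V)
      = partition_function V E w a b * ennreal (1 / Z)"
    using S' by (simp add: nn_integral_multc partition_function_def)
  then have int: "(\<integral>\<^sup>+ \<phi>. ennreal (phi4_density V E w a b \<phi>) \<partial>lebesgue_PiM V) < \<infinity>"
    using fin by (simp add: ennreal_mult_less_top)
  show ?thesis
    unfolding local_markov_property_def
  proof
    fix i assume i: "i \<in> V"
    let ?N = "neighbours V E i"
    let ?Si = "phi4_action {i} {e \<in> E. i \<in> e} w a b"
    let ?Sr = "phi4_action (V - {i}) {e \<in> E. i \<notin> e} w a b"
    \<comment> \<open>The local factor \<open>g\<close> carries all dependence on the field at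
      \<open>i\<close>; the constant \<open>1 / Z\<close> goes into \<open>h\<close>.\<close>
    define g where "g \<phi> = ennreal (exp (- ?Si \<phi>))" for \<phi>
    define h where "h \<phi> = ennreal (exp (- ?Sr \<phi>) / Z)" for \<phi>
    have [measurable]: "?Si \<in> borel_measurable (lebesgue_PiM V)"
      "?Sr \<in> borel_measurable (lebesgue_PiM V)"
      by (rule measurable_phi4_action; use sub i in auto)+
    have p: "(\<lambda>\<phi>. ennreal (phi4_density V E w a b \<phi>)) = (\<lambda>\<phi>. g \<phi> * h \<phi>)"
      using Z i assms(1,2)
      by (simp add: g_def h_def phi4_density_def phi4_action_remove[of V E i] exp_add exp_diff
          exp_minus field_simps flip: Z_def ennreal_mult)
    \<comment> \<open>The set \<open>{i, i}\<close> is the singleton \<open>{i}\<close>, which is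
      not an edge because edges have two distinct endpoints.\<close>
    have "insert i ?N \<subseteq> V" "i \<notin> ?N"
      using i edge[of "{i}"] by (auto simp: neighbours_def)
    moreover have "g \<phi> = g \<psi>" if "\<forall>j\<in>insert i ?N. \<phi> j = \<psi> j" for \<phi> \<psi>
    proof -
      \<comment> \<open>This is the locality of the interaction: the other endpoint of an edge at
        \<open>i\<close> is a neighbour of \<open>i\<close>.\<close>
      have "\<Union>{e \<in> E. i \<in> e} \<subseteq> insert i ?N"
        using edge by (fastforce simp: neighbours_def insert_commute)
      then have "?Si \<phi> = ?Si \<psi>" using that by (intro phi4_action_cong) auto
      then show ?thesis by (simp add: g_def)
    qed
    moreover have "h (\<phi>(i := y)) = h \<phi>" for \<phi> y
    proof -
      have "?Sr (\<phi>(i := y)) = ?Sr \<phi>" by (intro phi4_action_cong) auto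
      then show ?thesis by (simp add: h_def)
    qed
    moreover have "g \<in> borel_measurable (lebesgue_PiM V)" "h \<in> borel_measurable (lebesgue_PiM V)"
      unfolding g_def[abs_def] h_def[abs_def] by measurable
    moreover have "g \<phi> \<noteq> 0" "h \<phi> \<noteq> 0" for \<phi>
      using Z by (simp_all add: g_def h_def ennreal_eq_0_iff not_le)
    moreover have "(\<integral>\<^sup>+ \<phi>. g \<phi> * h \<phi> \<partial>lebesgue_PiM V) < \<infinity>"
      using int by (simp add: fun_cong[OF p])
    ultimately show "AE \<phi> in lebesgue_PiM V.
        conditional_density V (\<lambda>\<phi>. ennreal (phi4_density V E w a b \<phi>)) i (V - {i}) \<phi> =
        conditional_density V (\<lambda>\<phi>. ennreal (phi4_density V E w a b \<phi>)) i ?N \<phi>"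
      unfolding p by (intro AE_conditional_density_factorized_eq assms(1))
  qed
qed

theorem mainTheorem1:
  fixes L :: nat and bc :: boundary
    and w :: "(nat \<times> nat) set \<Rightarrow> real" and a b :: "nat \<times> nat \<Rightarrow> real"
  defines "V \<equiv> lattice_vertices L" and "E \<equiv> lattice_edges bc L"
  defines "p \<equiv> (\<lambda>\<phi>. ennreal (phi4_density V E w a b \<phi>))"
  assumes "L \<ge> 1"
    and "partition_function V E w a b < \<infinity>"
  shows "local_markov_property V E p \<and>
    (\<forall>(M :: 'w measure) X. prob_space M \<longrightarrow> has_joint_density M V X p \<longrightarrow>
       markov_random_field M V E X)"
proof -
  have V: "finite V" by (simp add: V_def lattice_vertices_def)
  have E: "finite E" by (simp add: E_def finite_lattice_edges)
  have edge: "\<exists>i j. e = {i, j} \<and> i \<in> V \<and> j \<in> V \<and> i \<noteq> j" if "e \<in> E" for e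
    using that unfolding E_def V_def lattice_edges_def by blast
  have p: "local_markov_property V E p"
    unfolding p_def by (rule phi4_local_markov_property[OF V E edge assms(5)])
  \<comment> \<open>The density \<open>p\<close> witnesses existence; every other version agrees
    with it almost everywhere and so inherits the property.\<close>
  have "markov_random_field M V E X"
    if "prob_space M" "has_joint_density M V X p" for M :: "'w measure" and X
    unfolding markov_random_field_def
    using that p has_joint_density_AE_unique[OF V _ that(2)]
      local_markov_property_cong_AE[OF V _ p] by blast
  with p show ?thesis by blast
qed

end
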